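(* A finite additively idempotent hemiring $R$ is $J_s$-semisimple (i.e. $J_s(R)=0$) if and only if it is semiisomorphic to a subdirect product of some hemirings $S_i$ $(i\in I)$ such that each $S_i$ $(i\in I)$, in turn, is isomorphic to a dense subhemiring of the endomorphism hemiring $\mathrm{End}(M_i)$ of a finite semilattice $M_i$ with zero.
   Context: A hemiring $(R,+,\cdot,0)$ consists of a commutative monoid $(R,+,0)$ and a semigroup $(R,\cdot)$ such that multiplication distributes over addition on both sides and $0r=0=r0$ for all $r$. It is additively idempotent if $a+a=a$ for all $a$. A left $R$-semimodule is a commutative monoid $(M,+,0_M)$ with a scalar multiplication $R\times M\to M$ satisfying $(rr')m=r(r'm)$, $r(m+m')=rm+rm'$, $(r+r')m=rm+r'm$, $r0_M=0_M=0m$. A left $R$-semimodule $M$ is simple if $RM\neq0$, its only subsemimodules are $0$ and $M$, and its only semimodule congruences are the diagonal and $M^2$. Let $(0:M)_R:=\{r\in R\mid rM=0\}$, and define $J_s(R):=\bigcap(0:M)_R$ over all simple left $R$-semimodules $M$ (with $J_s(R)=R$ if there are none). Let $M$ be a join semilattice with zero (least element) $0$, written additively with $+$ the join. $\mathrm{End}(M)$ is the hemiring of all endomorphisms of the monoid $(M,+,0)$, with pointwise addition and composition. For $a,b\in M$, $e_{a,b}\in\mathrm{End}(M)$ is defined by $e_{a,b}(x)=0$ if $x\le a$ and $e_{a,b}(x)=b$ otherwise. $\mathbf{F}_M$ is the submonoid of $(\mathrm{End}(M),+,0)$ generated by all $e_{a,b}$, $a,b\in M$. A subhemiring of $\mathrm{End}(M)$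 is dense if it contains $\mathbf{F}_M$. A semiisomorphism is a surjective hemiring homomorphism $f:R\to S$ with $\{a\mid f(a)=0\}=0$; $R$ is semiisomorphic to $S$ if there is a semiisomorphism $R\to S$. A subdirect product of hemirings $(S_i)_{i\in I}$ is a subhemiring of $\prod_{i\in I}S_i$ such that every projection restricted to it is surjective onto $S_i$. *)

theory Defs
  imports "HOL-Algebra.Module" "HOL-Algebra.Lattice" "HOL-Library.Infinite_Typeclass"
begin

text \<open>Hemirings are represented by the ring record of HOL-Algebra. A hemiring need not have
  a multiplicative identity, so the record field \<open>one\<close> is ignored throughout: no axiom and no
  notion below refers to it. In the same way semimodules are represented by the module record,
  whose fields \<open>mult\<close> and \<open>one\<close> are ignored.\<close>

locale hemiring = abelian_monoid R for R (structure) +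
  assumes m_closed: "\<lbrakk> x \<in> carrier R; y \<in> carrier R \<rbrakk> \<Longrightarrow> x \<otimes> y \<in> carrier R"
    and m_assoc: "\<lbrakk> x \<in> carrier R; y \<in> carrier R; z \<in> carrier R \<rbrakk>
      \<Longrightarrow> (x \<otimes> y) \<otimes> z = x \<otimes> (y \<otimes> z)"
    and l_distr: "\<lbrakk> x \<in> carrier R; y \<in> carrier R; z \<in> carrier R \<rbrakk>
      \<Longrightarrow> (x \<oplus> y) \<otimes> z = x \<otimes> z \<oplus> y \<otimes> z"
    and r_distr: "\<lbrakk> x \<in> carrier R; y \<in> carrier R; z \<in> carrier R \<rbrakk>
      \<Longrightarrow> z \<otimes> (x \<oplus> y) = z \<otimes> x \<oplus> z \<otimes> y"
    and l_null: "x \<in> carrier R \<Longrightarrow> \<zero> \<otimes> x = \<zero>"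
    and r_null: "x \<in> carrier R \<Longrightarrow> x \<otimes> \<zero> = \<zero>"

definition additively_idempotent :: "('a, 'z) ring_scheme \<Rightarrow> bool" where
  "additively_idempotent R \<longleftrightarrow> (\<forall>a\<in>carrier R. a \<oplus>\<^bsub>R\<^esub> a = a)"

definition subhemiring :: "'a set \<Rightarrow> ('a, 'z) ring_scheme \<Rightarrow> bool" where
  "subhemiring T R \<longleftrightarrow>
     submonoid T (add_monoid R) \<and> (\<forall>x\<in>T. \<forall>y\<in>T. x \<otimes>\<^bsub>R\<^esub> y \<in> T)"

definition hemiring_hom :: "('a, 'z) ring_scheme \<Rightarrow> ('b, 'y) ring_scheme \<Rightarrow> ('a \<Rightarrow> 'b) set" where
  "hemiring_hom R S =
     {f \<in> carrier R \<rightarrow> carrier S.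
        (\<forall>x\<in>carrier R. \<forall>y\<in>carrier R. f (x \<oplus>\<^bsub>R\<^esub> y) = f x \<oplus>\<^bsub>S\<^esub> f y) \<and>
        (\<forall>x\<in>carrier R. \<forall>y\<in>carrier R. f (x \<otimes>\<^bsub>R\<^esub> y) = f x \<otimes>\<^bsub>S\<^esub> f y) \<and>
        f \<zero>\<^bsub>R\<^esub> = \<zero>\<^bsub>S\<^esub>}"

definition hemiring_isomorphic :: "('a, 'z) ring_scheme \<Rightarrow> ('b, 'y) ring_scheme \<Rightarrow> bool" where
  "hemiring_isomorphic R S \<longleftrightarrow> (\<exists>f\<in>hemiring_hom R S. bij_betw f (carrier R) (carrier S))"

definition semiisomorphism ::
    "('a, 'z) ring_scheme \<Rightarrow> ('b, 'y) ring_scheme \<Rightarrow> ('a \<Rightarrow> 'b) \<Rightarrow> bool" where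
  "semiisomorphism R S f \<longleftrightarrow>
     f \<in> hemiring_hom R S \<and> f ` carrier R = carrier S \<and>
     {a \<in> carrier R. f a = \<zero>\<^bsub>S\<^esub>} = {\<zero>\<^bsub>R\<^esub>}"

definition semiisomorphic :: "('a, 'z) ring_scheme \<Rightarrow> ('b, 'y) ring_scheme \<Rightarrow> bool" where
  "semiisomorphic R S \<longleftrightarrow> (\<exists>f. semiisomorphism R S f)"

definition product_hemiring :: "'i set \<Rightarrow> ('i \<Rightarrow> ('s, 'z) ring_scheme) \<Rightarrow> ('i \<Rightarrow> 's) ring" where
  "product_hemiring I S =
     \<lparr> carrier = (\<Pi>\<^sub>E i\<in>I. carrier (S i)),
       mult = (\<lambda>f g. \<lambda>i\<in>I. f i \<otimes>\<^bsub>S i\<^esub> g i),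
       one = (\<lambda>i\<in>I. \<one>\<^bsub>S i\<^esub>),
       zero = (\<lambda>i\<in>I. \<zero>\<^bsub>S i\<^esub>),
       add = (\<lambda>f g. \<lambda>i\<in>I. f i \<oplus>\<^bsub>S i\<^esub> g i) \<rparr>"

definition subdirect_product ::
    "('i \<Rightarrow> 's) set \<Rightarrow> 'i set \<Rightarrow> ('i \<Rightarrow> ('s, 'z) ring_scheme) \<Rightarrow> bool" where
  "subdirect_product T I S \<longleftrightarrow>
     subhemiring T (product_hemiring I S) \<and> (\<forall>i\<in>I. (\<lambda>f. f i) ` T = carrier (S i))"


locale semimodule = R?: hemiring R + M?: abelian_monoid M
  for R (structure) and M :: "('a, 'm, 'y) module_scheme" (structure) +
  assumes smult_closed:
      "\<lbrakk> r \<in> carrier R; x \<in> carrier M \<rbrakk> \<Longrightarrow> r \<odot>\<^bsub>M\<^esub> x \<in> carrier M"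
    and smult_assoc:
      "\<lbrakk> r \<in> carrier R; s \<in> carrier R; x \<in> carrier M \<rbrakk>
        \<Longrightarrow> (r \<otimes>\<^bsub>R\<^esub> s) \<odot>\<^bsub>M\<^esub> x = r \<odot>\<^bsub>M\<^esub> (s \<odot>\<^bsub>M\<^esub> x)"
    and smult_r_distr:
      "\<lbrakk> r \<in> carrier R; x \<in> carrier M; y \<in> carrier M \<rbrakk>
        \<Longrightarrow> r \<odot>\<^bsub>M\<^esub> (x \<oplus>\<^bsub>M\<^esub> y) = r \<odot>\<^bsub>M\<^esub> x \<oplus>\<^bsub>M\<^esub> r \<odot>\<^bsub>M\<^esub> y"
    and smult_l_distr:
      "\<lbrakk> r \<in> carrier R; s \<in> carrier R; x \<in> carrier M \<rbrakk>
        \<Longrightarrow> (r \<oplus>\<^bsub>R\<^esub> s) \<odot>\<^bsub>M\<^esub> x = r \<odot>\<^bsub>M\<^esub> x \<oplus>\<^bsub>M\<^esub> s \<odot>\<^bsub>M\<^esub> x"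
    and smult_r_null: "r \<in> carrier R \<Longrightarrow> r \<odot>\<^bsub>M\<^esub> \<zero>\<^bsub>M\<^esub> = \<zero>\<^bsub>M\<^esub>"
    and smult_l_null: "x \<in> carrier M \<Longrightarrow> \<zero>\<^bsub>R\<^esub> \<odot>\<^bsub>M\<^esub> x = \<zero>\<^bsub>M\<^esub>"

definition subsemimodule ::
    "'m set \<Rightarrow> ('a, 'z) ring_scheme \<Rightarrow> ('a, 'm, 'y) module_scheme \<Rightarrow> bool" where
  "subsemimodule N R M \<longleftrightarrow>
     submonoid N (add_monoid M) \<and> (\<forall>r\<in>carrier R. \<forall>x\<in>N. r \<odot>\<^bsub>M\<^esub> x \<in> N)"

definition semimodule_congruence ::
    "('m \<times> 'm) set \<Rightarrow> ('a, 'z) ring_scheme \<Rightarrow> ('a, 'm, 'y) module_scheme \<Rightarrow> bool" where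
  "semimodule_congruence \<theta> R M \<longleftrightarrow>
     equiv (carrier M) \<theta> \<and>
     (\<forall>x x' y y'. (x, x') \<in> \<theta> \<longrightarrow> (y, y') \<in> \<theta> \<longrightarrow> (x \<oplus>\<^bsub>M\<^esub> y, x' \<oplus>\<^bsub>M\<^esub> y') \<in> \<theta>) \<and>
     (\<forall>r\<in>carrier R. \<forall>x x'. (x, x') \<in> \<theta> \<longrightarrow> (r \<odot>\<^bsub>M\<^esub> x, r \<odot>\<^bsub>M\<^esub> x') \<in> \<theta>)"

definition simple_semimodule ::
    "('a, 'z) ring_scheme \<Rightarrow> ('a, 'm, 'y) module_scheme \<Rightarrow> bool" where
  "simple_semimodule R M \<longleftrightarrow>
     semimodule R M \<and>
     (\<exists>r\<in>carrier R. \<exists>x\<in>carrier M. r \<odot>\<^bsub>M\<^esub> x \<noteq> \<zero>\<^bsub>M\<^esub>) \<and>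
     (\<forall>N. subsemimodule N R M \<longrightarrow> N = {\<zero>\<^bsub>M\<^esub>} \<or> N = carrier M) \<and>
     (\<forall>\<theta>. semimodule_congruence \<theta> R M \<longrightarrow>
        \<theta> = Id_on (carrier M) \<or> \<theta> = carrier M \<times> carrier M)"

definition left_annihilator ::
    "('a, 'z) ring_scheme \<Rightarrow> ('a, 'm, 'y) module_scheme \<Rightarrow> 'a set" where
  "left_annihilator R M = {r \<in> carrier R. \<forall>x\<in>carrier M. r \<odot>\<^bsub>M\<^esub> x = \<zero>\<^bsub>M\<^esub>}"

text \<open>A HOL definition cannot quantify over all types. Every simple semimodule \<open>M\<close> is of the form
  \<open>R m\<close>, hence has at most as many elements as \<open>R\<close>, and is therefore isomorphic to one
  whose carrier lies in the type of the elements of \<open>R\<close>. So nothing is lost by letting \<open>M\<close>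
  range over the semimodules in that type; the lemma \<open>Js_subset_left_annihilator\<close> below
  confirms this.\<close>

definition Js :: "('a, 'z) ring_scheme \<Rightarrow> 'a set" where
  "Js R = {r \<in> carrier R.
     \<forall>M :: ('a, 'a) module. simple_semimodule R M \<longrightarrow> r \<in> left_annihilator R M}"

definition Js_semisimple :: "('a, 'z) ring_scheme \<Rightarrow> bool" where
  "Js_semisimple R \<longleftrightarrow> Js R = {\<zero>\<^bsub>R\<^esub>}"


text \<open>Join semilattices with zero are carried by the general orders of HOL-Algebra; the sum is
  the join \<open>\<squnion>\<close>, and the zero is the least element \<open>\<bottom>\<close>.\<close>

locale semilattice_with_zero = upper_semilattice L + weak_partial_order_bottom L
  for L (structure)

text \<open>Maps on the carrier are made extensional, so that equality of endomorphisms is equality of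
  functions.\<close>

definition End_hemiring :: "('m, 'z) gorder_scheme \<Rightarrow> ('m \<Rightarrow> 'm) ring" where
  "End_hemiring L =
     \<lparr> carrier = {f \<in> carrier L \<rightarrow>\<^sub>E carrier L.
         (\<forall>x\<in>carrier L. \<forall>y\<in>carrier L. f (x \<squnion>\<^bsub>L\<^esub> y) = f x \<squnion>\<^bsub>L\<^esub> f y) \<and> f \<bottom>\<^bsub>L\<^esub> = \<bottom>\<^bsub>L\<^esub>},
       mult = (\<lambda>f g. compose (carrier L) f g),
       one = (\<lambda>x\<in>carrier L. x),
       zero = (\<lambda>x\<in>carrier L. \<bottom>\<^bsub>L\<^esub>),
       add = (\<lambda>f g. \<lambda>x\<in>carrier L. f x \<squnion>\<^bsub>L\<^esub> g x) \<rparr>"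

definition elementary_endo :: "('m, 'z) gorder_scheme \<Rightarrow> 'm \<Rightarrow> 'm \<Rightarrow> 'm \<Rightarrow> 'm" where
  "elementary_endo L a b = (\<lambda>x\<in>carrier L. if x \<sqsubseteq>\<^bsub>L\<^esub> a then \<bottom>\<^bsub>L\<^esub> else b)"

definition F_submonoid :: "('m, 'z) gorder_scheme \<Rightarrow> ('m \<Rightarrow> 'm) set" where
  "F_submonoid L =
     \<Inter> {H. submonoid H (add_monoid (End_hemiring L)) \<and>
           {elementary_endo L a b | a b. a \<in> carrier L \<and> b \<in> carrier L} \<subseteq> H}"

definition dense_subhemiring :: "('m \<Rightarrow> 'm) set \<Rightarrow> ('m, 'z) gorder_scheme \<Rightarrow> bool" where
  "dense_subhemiring D L \<longleftrightarrow> subhemiring D (End_hemiring L) \<and> F_submonoid L \<subseteq> D"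

text \<open>Existential quantifiers over families of hemirings \<open>S i\<close> (\<open>i \<in> I\<close>) and semilattices range
  over subsets of arbitrary types of class \<open>infinite\<close>. This makes the choice of types harmless:
  for a finite hemiring only finitely many indices with finite \<open>S i\<close> and \<open>M i\<close> are needed, which
  fit into any infinite type, while every type embeds into an infinite one.\<close>

lemma simple_semimodule_cyclic:
  assumes "simple_semimodule R M"
  obtains m where "m \<in> carrier M" "(\<lambda>r. r \<odot>\<^bsub>M\<^esub> m) ` carrier R = carrier M"
proof -
  interpret semimodule R M using assms by (simp add: simple_semimodule_def)
  obtain r m where rm: "r \<in> carrier R" "m \<in> carrier M" "r \<odot>\<^bsub>M\<^esub> m \<noteq> \<zero>\<^bsub>M\<^esub>"
    using assms by (auto simp: simple_semimodule_def)
  let ?N = "(\<lambda>r. r \<odot>\<^bsub>M\<^esub> m) ` carrier R"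
  have "submonoid ?N (add_monoid M)"
  proof (rule submonoid.intro)
    show "?N \<subseteq> carrier (add_monoid M)" using rm smult_closed by auto
    show "\<one>\<^bsub>add_monoid M\<^esub> \<in> ?N"
      by (rule image_eqI[where x = "\<zero>\<^bsub>R\<^esub>"]) (use rm smult_l_null in auto)
  next
    fix x y assume "x \<in> ?N" "y \<in> ?N"
    then obtain s t where "s \<in> carrier R" "x = s \<odot>\<^bsub>M\<^esub> m" "t \<in> carrier R" "y = t \<odot>\<^bsub>M\<^esub> m"
      by auto
    then show "x \<otimes>\<^bsub>add_monoid M\<^esub> y \<in> ?N"
      using rm by (intro image_eqI[where x = "s \<oplus>\<^bsub>R\<^esub> t"]) (auto simp: smult_l_distr)
  qed
  moreover have "s \<odot>\<^bsub>M\<^esub> x \<in> ?N" if sx: "s \<in> carrier R" "x \<in> ?N" for s x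
  proof -
    obtain t where t: "t \<in> carrier R" "x = t \<odot>\<^bsub>M\<^esub> m" using sx by auto
    then have "s \<odot>\<^bsub>M\<^esub> x = (s \<otimes>\<^bsub>R\<^esub> t) \<odot>\<^bsub>M\<^esub> m" using sx rm smult_assoc by simp
    then show ?thesis using sx t m_closed by blast
  qed
  ultimately have "subsemimodule ?N R M" by (simp add: subsemimodule_def)
  then have "?N = {\<zero>\<^bsub>M\<^esub>} \<or> ?N = carrier M" using assms by (simp add: simple_semimodule_def)
  then have "?N = carrier M" using rm by auto
  then show ?thesis using that rm by blast
qed

lemma simple_semimodule_transport:
  fixes M :: "('a, 'm, 'y) module_scheme" and g :: "'m \<Rightarrow> 'n"
  assumes M: "simple_semimodule R M" and inj: "inj_on g (carrier M)"
  defines "h \<equiv> inv_into (carrier M) g"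
  defines "M' \<equiv> \<lparr> carrier = g ` carrier M, mult = undefined, one = undefined,
      zero = g \<zero>\<^bsub>M\<^esub>, add = (\<lambda>x y. g (h x \<oplus>\<^bsub>M\<^esub> h y)), smult = (\<lambda>r x. g (r \<odot>\<^bsub>M\<^esub> h x)) \<rparr>"
  shows "simple_semimodule R M'" "left_annihilator R M' = left_annihilator R M"
proof -
  interpret semimodule R M using M by (simp add: simple_semimodule_def)
  have hg: "h (g x) = x" if "x \<in> carrier M" for x
    using that inj by (simp add: h_def)
  have geq: "g x = g y \<longleftrightarrow> x = y" if "x \<in> carrier M" "y \<in> carrier M" for x y
    using that inj by (auto dest: inj_onD)
  have M': "carrier M' = g ` carrier M" "zero M' = g \<zero>\<^bsub>M\<^esub>"
     "add M' = (\<lambda>x y. g (h x \<oplus>\<^bsub>M\<^esub> h y))" "smult M' = (\<lambda>r x. g (r \<odot>\<^bsub>M\<^esub> h x))"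
    by (simp_all add: M'_def)
  note cl = smult_closed M.a_closed M.zero_closed R.a_closed R.zero_closed m_closed
  have ab: "abelian_monoid M'"
    by (rule abelian_monoidI) (auto simp: M' hg cl M.add.m_ac)
  have sm: "semimodule R M'"
    by (intro semimodule.intro semimodule_axioms.intro ab hemiring_axioms)
       (auto simp: M' hg cl smult_assoc smult_r_distr smult_l_distr smult_r_null smult_l_null)
  obtain r x where rx: "r \<in> carrier R" "x \<in> carrier M" "r \<odot>\<^bsub>M\<^esub> x \<noteq> \<zero>\<^bsub>M\<^esub>"
    using M by (auto simp: simple_semimodule_def)
  have nz: "\<exists>r\<in>carrier R. \<exists>x\<in>carrier M'. r \<odot>\<^bsub>M'\<^esub> x \<noteq> \<zero>\<^bsub>M'\<^esub>"
    by (rule bexI[OF _ rx(1)], rule bexI[of _ "g x"]) (use rx in \<open>auto simp: M' hg geq cl\<close>)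
  have sub: "N = {\<zero>\<^bsub>M'\<^esub>} \<or> N = carrier M'" if N: "subsemimodule N R M'" for N
  proof -
    interpret N: submonoid N "add_monoid M'" using N by (simp add: subsemimodule_def)
    have Ns: "N \<subseteq> g ` carrier M" using N.subset by (simp add: M')
    let ?N = "{x \<in> carrier M. g x \<in> N}"
    have eq: "N = g ` ?N" using Ns by auto
    have "submonoid ?N (add_monoid M)"
    proof (rule submonoid.intro)
      fix x y assume "x \<in> ?N" "y \<in> ?N"
      then show "x \<otimes>\<^bsub>add_monoid M\<^esub> y \<in> ?N"
        using N.m_closed[of "g x" "g y"] by (auto simp: M' hg)
    qed (use N.one_closed in \<open>auto simp: M'\<close>)
    moreover have "s \<odot>\<^bsub>M\<^esub> x \<in> ?N" if "s \<in> carrier R" "x \<in> ?N" for s x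
    proof -
      have "s \<odot>\<^bsub>M'\<^esub> g x \<in> N" using N that by (simp add: subsemimodule_def)
      then show ?thesis using that by (simp add: M' hg cl)
    qed
    ultimately have "subsemimodule ?N R M" by (simp add: subsemimodule_def)
    then have "?N = {\<zero>\<^bsub>M\<^esub>} \<or> ?N = carrier M" using M by (simp add: simple_semimodule_def)
    then show ?thesis using eq by (auto simp: M')
  qed
  have cong: "\<theta> = Id_on (carrier M') \<or> \<theta> = carrier M' \<times> carrier M'"
    if t: "semimodule_congruence \<theta> R M'" for \<theta>
  proof -
    let ?t = "{(x, y). x \<in> carrier M \<and> y \<in> carrier M \<and> (g x, g y) \<in> \<theta>}"
    have e: "equiv (g ` carrier M) \<theta>" using t by (simp add: semimodule_congruence_def M')
    have sub: "\<theta> \<subseteq> g ` carrier M \<times> g ` carrier M" using e by (simp add: equiv_def)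
    have eq: "\<theta> = (\<lambda>(x, y). (g x, g y)) ` ?t" using sub by (force simp: image_iff)
    have "equiv (carrier M) ?t"
      using e by (intro equivI refl_onI symI transI)
        (auto simp: equiv_def refl_on_def dest: symD transD)
    moreover have "(x \<oplus>\<^bsub>M\<^esub> y, x' \<oplus>\<^bsub>M\<^esub> y') \<in> ?t" if "(x, x') \<in> ?t" "(y, y') \<in> ?t" for x x' y y'
    proof -
      have "(g x \<oplus>\<^bsub>M'\<^esub> g y, g x' \<oplus>\<^bsub>M'\<^esub> g y') \<in> \<theta>"
        using t that unfolding semimodule_congruence_def by blast
      then show ?thesis using that by (simp add: M' hg)
    qed
    moreover have "(s \<odot>\<^bsub>M\<^esub> x, s \<odot>\<^bsub>M\<^esub> x') \<in> ?t" if "s \<in> carrier R" "(x, x') \<in> ?t" for s x x'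
    proof -
      have "(s \<odot>\<^bsub>M'\<^esub> g x, s \<odot>\<^bsub>M'\<^esub> g x') \<in> \<theta>"
        using t that unfolding semimodule_congruence_def by blast
      then show ?thesis using that by (simp add: M' hg cl)
    qed
    ultimately have "semimodule_congruence ?t R M"
      unfolding semimodule_congruence_def by blast
    then have "?t = Id_on (carrier M) \<or> ?t = carrier M \<times> carrier M"
      using M by (simp add: simple_semimodule_def)
    then show ?thesis
    proof
      assume "?t = Id_on (carrier M)"
      then have "\<theta> = (\<lambda>(x, y). (g x, g y)) ` Id_on (carrier M)" using eq by simp
      also have "\<dots> = Id_on (carrier M')" by (auto simp: M' Id_on_def image_iff)
      finally show ?thesis by simp
    next
      assume "?t = carrier M \<times> carrier M"
      then have "\<theta> = (\<lambda>(x, y). (g x, g y)) ` (carrier M \<times> carrier M)" using eq by simp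
      also have "\<dots> = carrier M' \<times> carrier M'" by (auto simp: M' image_iff)
      finally show ?thesis by simp
    qed
  qed
  show "simple_semimodule R M'"
    using sm nz sub cong by (simp add: simple_semimodule_def)
  show "left_annihilator R M' = left_annihilator R M"
    by (auto simp: left_annihilator_def M' hg geq cl)
qed

lemma Js_subset_left_annihilator:
  fixes R :: "('a, 'z) ring_scheme" and M :: "('a, 'm, 'y) module_scheme"
  assumes "simple_semimodule R M"
  shows "Js R \<subseteq> left_annihilator R M"
proof -
  obtain m where m: "m \<in> carrier M" "(\<lambda>r. r \<odot>\<^bsub>M\<^esub> m) ` carrier R = carrier M"
    using simple_semimodule_cyclic[OF assms] .
  have inj: "inj_on (inv_into (carrier R) (\<lambda>r. r \<odot>\<^bsub>M\<^esub> m)) (carrier M)"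
    by (rule inj_on_inv_into) (simp add: m)
  show ?thesis
    using simple_semimodule_transport[OF assms inj] unfolding Js_def by blast
qed

lemma hemiring_product_hemiring:
  assumes "\<And>i. i \<in> I \<Longrightarrow> hemiring (S i)"
  shows "hemiring (product_hemiring I S)"
proof -
  have am: "abelian_monoid (S i)" if "i \<in> I" for i
    using assms[OF that] by (simp add: hemiring_def)
  note [simp] = abelian_monoid.a_assoc[OF am] abelian_monoid.a_comm[OF am] abelian_monoid.a_lcomm[OF am]
    abelian_monoid.a_closed[OF am] abelian_monoid.zero_closed[OF am] abelian_monoid.l_zero[OF am] abelian_monoid.r_zero[OF am]
    hemiring.m_closed[OF assms] hemiring.m_assoc[OF assms] hemiring.l_distr[OF assms]
    hemiring.r_distr[OF assms] hemiring.l_null[OF assms] hemiring.r_null[OF assms]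
  show ?thesis
  proof (intro hemiring.intro hemiring_axioms.intro abelian_monoidI)
    fix f assume "f \<in> carrier (product_hemiring I S)"
    then show "\<zero>\<^bsub>product_hemiring I S\<^esub> \<oplus>\<^bsub>product_hemiring I S\<^esub> f = f"
      by (auto simp: product_hemiring_def PiE_def extensional_def fun_eq_iff Pi_iff)
  qed (auto simp: product_hemiring_def PiE_iff restrict_def extensional_def fun_eq_iff)
qed

context semilattice_with_zero
begin

lemma join_props:
  assumes "x \<in> carrier L" "y \<in> carrier L" "z \<in> carrier L"
  shows "x \<squnion> y \<in> carrier L" "(x \<squnion> y) \<squnion> z = x \<squnion> (y \<squnion> z)" "x \<squnion> y = y \<squnion> x"
    "\<bottom> \<squnion> x = x" "x \<squnion> x = x" "x \<sqsubseteq> y \<longleftrightarrow> x \<squnion> y = y"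
proof -
  show cl: "x \<squnion> y \<in> carrier L" using assms by simp
  show "(x \<squnion> y) \<squnion> z = x \<squnion> (y \<squnion> z)"
    using weak_join_assoc[OF assms] assms by (simp add: eq_is_equal)
  show "x \<squnion> y = y \<squnion> x" by (rule join_comm)
  show "\<bottom> \<squnion> x = x"
    using assms by (intro le_antisym join_le) (auto intro: join_right)
  show "x \<squnion> x = x"
    using assms by (intro le_antisym join_le) (auto intro: join_right)
  show "x \<sqsubseteq> y \<longleftrightarrow> x \<squnion> y = y"
    using assms by (metis join_left join_right join_le le_antisym le_refl cl)
qed

lemma hemiring_End_hemiring: "hemiring (End_hemiring L)"
proof -
  have lc: "x \<squnion> (y \<squnion> z) = y \<squnion> (x \<squnion> z)"
    if "x \<in> carrier L" "y \<in> carrier L" "z \<in> carrier L" for x y z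
    using that join_props by metis
  note jp = join_props lc join_props(5)[OF bottom_closed bottom_closed bottom_closed]
  show ?thesis
  proof (intro hemiring.intro hemiring_axioms.intro abelian_monoidI)
    fix f assume "f \<in> carrier (End_hemiring L)"
    then show "\<zero>\<^bsub>End_hemiring L\<^esub> \<oplus>\<^bsub>End_hemiring L\<^esub> f = f"
      by (auto simp: End_hemiring_def PiE_def extensional_def fun_eq_iff jp Pi_iff)
  qed (auto simp: End_hemiring_def PiE_iff restrict_def compose_def extensional_def fun_eq_iff jp)
qed

lemma elementary_endo_in_End:
  assumes "a \<in> carrier L" "b \<in> carrier L"
  shows "elementary_endo L a b \<in> carrier (End_hemiring L)"
proof -
  have "x \<squnion> y \<sqsubseteq> a \<longleftrightarrow> x \<sqsubseteq> a \<and> y \<sqsubseteq> a" if "x \<in> carrier L" "y \<in> carrier L" for x y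
    using that assms by (meson join_closed join_le join_left join_right le_trans)
  moreover have "\<bottom> \<squnion> b = b" "b \<squnion> \<bottom> = b" "b \<squnion> b = b" "\<bottom> \<squnion> \<bottom> = \<bottom>"
    using assms join_props(3-5) by (metis bottom_closed)+
  ultimately show ?thesis
    using assms by (auto simp: End_hemiring_def elementary_endo_def)
qed

end

end

theory Submission
  imports Defs
begin

text \<open>The theorem rests on a correspondence: the simple left semimodules of a finite additively
  idempotent hemiring \<open>R\<close> are, up to isomorphism, the finite semilattices \<open>M\<close> with zero on which
  \<open>R\<close> acts through a nonzero dense subhemiring of \<open>End(M)\<close>.

  One direction needs only the maps \<open>e\<^bsub>a,b\<^esub>\<close>. If \<open>x \<noteq> 0\<close>, then \<open>e\<^bsub>0,b\<^esub>\<close> sends \<open>x\<close> to \<open>b\<close>, so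
  every nonzero subsemimodule is everything. If a congruence relates distinct
  \<open>x\<close> and \<open>y\<close>, named such that \<open>x \<not>\<le> y\<close>, then applying \<open>e\<^bsub>y,b\<^esub>\<close> shows that it relates \<open>b\<close> and \<open>0\<close>, so it is everything
  (\<open>simple_endo_semimodule\<close>). Hence, if \<open>R\<close> maps semiisomorphically to a subdirect product of
  dense hemirings, a nonzero \<open>r\<close> is nonzero in some component and therefore acts nontrivially on
  a simple semimodule, so that \<open>r \<notin> J\<^sub>s(R)\<close>.

  The other direction is a density theorem. Let \<open>M\<close> be simple. It is cyclic, so it is finite and
  idempotent, that is, a semilattice. Having the same annihilator \<open>(0:x)\<close> is a congruence on \<open>M\<close>,
  and it is not the full relation because \<open>RM \<noteq> 0\<close>; hence \<open>(0:x)\<close> determines \<open>x\<close>. Fix \<open>a\<close>. If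
  \<open>(0:a)x = 0\<close>, then \<open>(0:x + a) = (0:x) \<inter> (0:a) = (0:a)\<close>, so \<open>x + a = a\<close>. Thus \<open>(0:a)x\<close>, which
  is a subsemimodule, is all of \<open>M\<close> whenever \<open>x \<not>\<le> a\<close>. The sum of the finitely many elements of
  \<open>(0:a)\<close> then sends every \<open>x \<le> a\<close> to \<open>0\<close> and every other \<open>x\<close> to the greatest element \<open>t\<close>.
  Finally \<open>Rt\<close> is nonzero by monotonicity, so \<open>qt = b\<close> for some \<open>q\<close>, and following the sum by \<open>q\<close>
  gives \<open>e\<^bsub>a,b\<^esub>\<close> (\<open>elementary_action_exists\<close>). If \<open>J\<^sub>s(R) = 0\<close>, choose for every \<open>r \<noteq> 0\<close> a
  simple semimodule not annihilated by \<open>r\<close>; the joint action on all of these is the required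
  semiisomorphism.\<close>

section \<open>Homomorphisms and images of hemirings\<close>

lemma hemiring_homD:
  assumes "f \<in> hemiring_hom R S"
  shows "x \<in> carrier R \<Longrightarrow> f x \<in> carrier S"
    and "\<lbrakk> x \<in> carrier R; y \<in> carrier R \<rbrakk> \<Longrightarrow> f (x \<oplus>\<^bsub>R\<^esub> y) = f x \<oplus>\<^bsub>S\<^esub> f y"
    and "\<lbrakk> x \<in> carrier R; y \<in> carrier R \<rbrakk> \<Longrightarrow> f (x \<otimes>\<^bsub>R\<^esub> y) = f x \<otimes>\<^bsub>S\<^esub> f y"
    and "f \<zero>\<^bsub>R\<^esub> = \<zero>\<^bsub>S\<^esub>"
  using assms by (auto simp: hemiring_hom_def)

lemma hemiring_hom_comp:
  assumes "f \<in> hemiring_hom R S" "g \<in> hemiring_hom S T"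
  shows "(\<lambda>x. g (f x)) \<in> hemiring_hom R T"
  using assms by (auto simp: hemiring_hom_def Pi_iff)

lemma subhemiring_image:
  assumes "hemiring R" "f \<in> hemiring_hom R S"
  shows "subhemiring (f ` carrier R) S"
proof -
  interpret hemiring R by fact
  note f = hemiring_homD[OF assms(2)]
  have "submonoid (f ` carrier R) (add_monoid S)"
  proof (rule submonoid.intro)
    show "\<one>\<^bsub>add_monoid S\<^esub> \<in> f ` carrier R"
      using f(4) zero_closed by (metis imageI monoid.select_convs(2))
  qed (auto simp: f(1) f(2)[symmetric])
  then show ?thesis
    by (auto simp: subhemiring_def f(3)[symmetric] m_closed)
qed

lemma hemiring_subhemiring:
  assumes "hemiring S" "subhemiring D S"
  shows "hemiring (S\<lparr>carrier := D\<rparr>)"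
proof -
  interpret hemiring S by fact
  interpret D: submonoid D "add_monoid S" using assms(2) by (simp add: subhemiring_def)
  have sub: "x \<in> carrier S" if "x \<in> D" for x using that D.subset by auto
  show ?thesis
    by (intro hemiring.intro hemiring_axioms.intro abelian_monoidI)
       (use D.m_closed D.one_closed assms(2) in
         \<open>auto simp: sub add.m_ac m_assoc l_distr r_distr l_null r_null subhemiring_def\<close>)
qed

text \<open>A factor arises as a hemiring of maps, whereas the factors of a subdirect product have to be
  carried by one prescribed type. Renaming its elements along an injection moves it there.\<close>

lemma hemiring_transport:
  fixes S :: "('b, 'z) ring_scheme" and g :: "'b \<Rightarrow> 'c"
  assumes "hemiring S" and inj: "inj_on g (carrier S)"
  obtains S' :: "'c ring"
  where "hemiring S'" "g \<in> hemiring_hom S S'" "carrier S' = g ` carrier S"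
    "hemiring_isomorphic S' S"
proof -
  interpret hemiring S by fact
  define h where "h = inv_into (carrier S) g"
  have hg: "h (g x) = x" if "x \<in> carrier S" for x
    using that inj by (simp add: h_def)
  define S' :: "'c ring" where "S' = \<lparr> carrier = g ` carrier S,
      mult = (\<lambda>x y. g (h x \<otimes>\<^bsub>S\<^esub> h y)), one = undefined,
      zero = g \<zero>\<^bsub>S\<^esub>, add = (\<lambda>x y. g (h x \<oplus>\<^bsub>S\<^esub> h y)) \<rparr>"
  have S': "carrier S' = g ` carrier S" "zero S' = g \<zero>\<^bsub>S\<^esub>"
     "add S' = (\<lambda>x y. g (h x \<oplus>\<^bsub>S\<^esub> h y))" "mult S' = (\<lambda>x y. g (h x \<otimes>\<^bsub>S\<^esub> h y))"
    by (simp_all add: S'_def)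
  have hem: "hemiring S'"
    by (intro hemiring.intro hemiring_axioms.intro abelian_monoidI)
       (auto simp: S' hg add.m_ac m_closed m_assoc l_distr r_distr l_null r_null)
  have hom: "g \<in> hemiring_hom S S'"
    by (auto simp: hemiring_hom_def S' hg)
  have "h \<in> hemiring_hom S' S"
    by (auto simp: hemiring_hom_def S' hg m_closed)
  moreover have "bij_betw h (carrier S') (carrier S)"
    by (rule bij_betw_byWitness[where f' = g]) (auto simp: S' hg)
  ultimately have "hemiring_isomorphic S' S"
    by (auto simp: hemiring_isomorphic_def)
  with hem hom S'(1) show ?thesis by (rule that)
qed

text \<open>The product of the maps \<open>\<phi> i\<close> has kernel zero as soon as their kernels intersect in zero. It
  may still fail to be injective, since a hemiring homomorphism with kernel zero need not be
  injective; this is why subdirect representations here give semiisomorphisms rather than isomorphisms.\<close>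

lemma semiisomorphic_subdirect_product:
  fixes S :: "'i \<Rightarrow> ('s, 'z) ring_scheme"
  assumes R: "hemiring R"
    and \<phi>: "\<And>i. i \<in> I \<Longrightarrow> \<phi> i \<in> hemiring_hom R (S i)"
    and onto: "\<And>i. i \<in> I \<Longrightarrow> \<phi> i ` carrier R = carrier (S i)"
    and ker: "\<And>r. \<lbrakk> r \<in> carrier R; \<And>i. i \<in> I \<Longrightarrow> \<phi> i r = \<zero>\<^bsub>S i\<^esub> \<rbrakk> \<Longrightarrow> r = \<zero>\<^bsub>R\<^esub>"
  obtains T where "subdirect_product T I S"
    "semiisomorphic R ((product_hemiring I S)\<lparr>carrier := T\<rparr>)"
proof -
  interpret hemiring R by fact
  define f where "f r = (\<lambda>i\<in>I. \<phi> i r)" for r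
  note \<phi>D = hemiring_homD[OF \<phi>]
  have f: "f \<in> hemiring_hom R (product_hemiring I S)"
    by (auto simp: hemiring_hom_def product_hemiring_def f_def \<phi>D fun_eq_iff)
  have "(\<lambda>t. t i) ` f ` carrier R = carrier (S i)" if "i \<in> I" for i
    using that onto[OF that] by (simp add: f_def image_image)
  then have "subdirect_product (f ` carrier R) I S"
    by (simp add: subdirect_product_def subhemiring_image[OF R f])
  moreover have "r = \<zero>\<^bsub>R\<^esub>"
    if "r \<in> carrier R" "f r = \<zero>\<^bsub>product_hemiring I S\<^esub>" for r
  proof (rule ker[OF that(1)])
    fix i assume "i \<in> I"
    then show "\<phi> i r = \<zero>\<^bsub>S i\<^esub>"
      using fun_cong[OF that(2), of i] by (simp add: f_def product_hemiring_def)
  qed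
  then have "semiisomorphism R ((product_hemiring I S)\<lparr>carrier := f ` carrier R\<rparr>) f"
    using hemiring_homD[OF f] by (auto simp: semiisomorphism_def hemiring_hom_def)
  ultimately show ?thesis by (intro that) (auto simp: semiisomorphic_def)
qed

section \<open>Dense endomorphism hemirings act simply\<close>

definition endo_semimodule ::
    "('m, 'z) gorder_scheme \<Rightarrow> ('a \<Rightarrow> 'm \<Rightarrow> 'm) \<Rightarrow> ('a, 'm) module" where
  "endo_semimodule L \<rho> =
     \<lparr> carrier = carrier L, mult = undefined, one = undefined,
       zero = \<bottom>\<^bsub>L\<^esub>, add = (\<lambda>x y. x \<squnion>\<^bsub>L\<^esub> y), smult = \<rho> \<rparr>"

lemma elementary_endo_in_dense:
  assumes "dense_subhemiring D L" "a \<in> carrier L" "b \<in> carrier L"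
  shows "elementary_endo L a b \<in> D"
proof -
  have "elementary_endo L a b \<in> F_submonoid L"
    using assms(2,3) by (auto simp: F_submonoid_def)
  then show ?thesis using assms(1) by (auto simp: dense_subhemiring_def)
qed

context semilattice_with_zero
begin

lemma semimodule_endo_semimodule:
  assumes "hemiring R" and \<rho>: "\<rho> \<in> hemiring_hom R (End_hemiring L)"
  shows "semimodule R (endo_semimodule L \<rho>)"
proof -
  interpret R: hemiring R by fact
  note \<rho>D = hemiring_homD[OF \<rho>]
  have null: "\<rho> \<zero>\<^bsub>R\<^esub> x = \<bottom>" if "x \<in> carrier L" for x
    using that \<rho>D(4) by (auto simp: End_hemiring_def)
  have End_bot: "\<rho> r \<bottom> = \<bottom>" if "r \<in> carrier R" for r
    using \<rho>D(1)[OF that] by (auto simp: End_hemiring_def)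
  have End: "\<rho> r x \<in> carrier L" "\<rho> r (x \<squnion> y) = \<rho> r x \<squnion> \<rho> r y"
    if "r \<in> carrier R" "x \<in> carrier L" "y \<in> carrier L" for r x y
    using \<rho>D(1)[OF that(1)] that(2,3) by (auto simp: End_hemiring_def)
  have ops: "\<rho> (r \<otimes>\<^bsub>R\<^esub> s) x = \<rho> r (\<rho> s x)" "\<rho> (r \<oplus>\<^bsub>R\<^esub> s) x = \<rho> r x \<squnion> \<rho> s x"
    if "r \<in> carrier R" "s \<in> carrier R" "x \<in> carrier L" for r s x
    using that \<rho>D(2,3)[of r s] by (auto simp: End_hemiring_def compose_def)
  show ?thesis
    by (intro semimodule.intro semimodule_axioms.intro abelian_monoidI R.hemiring_axioms)
       (auto simp: endo_semimodule_def join_props(2,4) End End_bot ops null intro: join_props(3))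
qed

text \<open>The map \<open>e\<^bsub>0,b\<^esub>\<close> carries any nonzero element to \<open>b\<close>, and \<open>e\<^bsub>y,b\<^esub>\<close> turns a related pair
  \<open>(x, y)\<close> with \<open>x \<not>\<le> y\<close> into \<open>(b, 0)\<close>. As \<open>b\<close> is arbitrary, no proper nonzero subsemimodule and
  no proper nontrivial congruence survives.\<close>

lemma simple_endo_semimodule:
  assumes R: "hemiring R" and \<rho>: "\<rho> \<in> hemiring_hom R (End_hemiring L)"
    and dense: "dense_subhemiring (\<rho> ` carrier R) L"
    and nz: "r \<in> carrier R" "\<rho> r \<noteq> \<zero>\<^bsub>End_hemiring L\<^esub>"
  shows "simple_semimodule R (endo_semimodule L \<rho>)"
    and "r \<notin> left_annihilator R (endo_semimodule L \<rho>)"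
proof -
  let ?M = "endo_semimodule L \<rho>"
  have M: "carrier ?M = carrier L" "zero ?M = \<bottom>" "add ?M = (\<lambda>x y. x \<squnion> y)" "smult ?M = \<rho>"
    by (simp_all add: endo_semimodule_def)
  have elem: "\<exists>s\<in>carrier R. \<forall>x\<in>carrier L. \<rho> s x = (if x \<sqsubseteq> a then \<bottom> else b)"
    if ab: "a \<in> carrier L" "b \<in> carrier L" for a b
  proof -
    obtain s where s: "s \<in> carrier R" "elementary_endo L a b = \<rho> s"
      using elementary_endo_in_dense[OF dense ab] by auto
    have "\<rho> s x = (if x \<sqsubseteq> a then \<bottom> else b)" if "x \<in> carrier L" for x
      using that by (simp add: s(2)[symmetric] elementary_endo_def)
    with s(1) show ?thesis by blast
  qed
  have "\<rho> r \<in> extensional (carrier L)"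
    using hemiring_homD(1)[OF \<rho> nz(1)] by (auto simp: End_hemiring_def PiE_def)
  moreover have "\<zero>\<^bsub>End_hemiring L\<^esub> = (\<lambda>x\<in>carrier L. \<bottom>)"
    by (simp add: End_hemiring_def)
  ultimately have "\<exists>z\<in>carrier L. \<rho> r z \<noteq> \<bottom>"
    using nz(2) by (metis extensionalityI restrict_apply' restrict_extensional)
  then obtain z where z: "z \<in> carrier L" "\<rho> r z \<noteq> \<bottom>" by auto
  show "r \<notin> left_annihilator R ?M"
    using z by (auto simp: left_annihilator_def M)
  have sub: "N = {\<zero>\<^bsub>?M\<^esub>} \<or> N = carrier ?M" if N: "subsemimodule N R ?M" for N
  proof (cases "N \<subseteq> {\<bottom>}")
    case True
    then show ?thesis using N by (auto simp: subsemimodule_def submonoid_def M)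
  next
    case False
    then obtain x where x: "x \<in> N" "x \<noteq> \<bottom>" by auto
    have NL: "N \<subseteq> carrier L" using N by (auto simp: subsemimodule_def submonoid_def M)
    have "\<not> x \<sqsubseteq> \<bottom>" using x NL le_antisym[of x \<bottom>] by blast
    have "b \<in> N" if "b \<in> carrier L" for b
    proof -
      obtain s where s: "s \<in> carrier R" "\<forall>x\<in>carrier L. \<rho> s x = (if x \<sqsubseteq> \<bottom> then \<bottom> else b)"
        using elem[OF bottom_closed \<open>b \<in> carrier L\<close>] by auto
      then have "\<rho> s x = b" using x NL \<open>\<not> x \<sqsubseteq> \<bottom>\<close> by auto
      then show ?thesis using N x s(1) by (auto simp: subsemimodule_def M)
    qed
    then show ?thesis using NL by (auto simp: M)
  qed
  have cong: "\<theta> = Id_on (carrier ?M) \<or> \<theta> = carrier ?M \<times> carrier ?M"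
    if t: "semimodule_congruence \<theta> R ?M" for \<theta>
  proof -
    have e: "equiv (carrier L) \<theta>" using t by (simp add: semimodule_congruence_def M)
    have sm: "(\<rho> s x, \<rho> s y) \<in> \<theta>" if "s \<in> carrier R" "(x, y) \<in> \<theta>" for s x y
      using t that by (auto simp: semimodule_congruence_def M)
    have in_L: "x \<in> carrier L" "y \<in> carrier L" if "(x, y) \<in> \<theta>" for x y
      using e that by (auto simp: equiv_def)
    have sym: "(y, x) \<in> \<theta>" if "(x, y) \<in> \<theta>" for x y
      using e that by (auto simp: equiv_def dest: symD)
    have trans: "(x, z) \<in> \<theta>" if "(x, y) \<in> \<theta>" "(y, z) \<in> \<theta>" for x y z
      using e that by (auto simp: equiv_def dest: transD)
    have refl: "(x, x) \<in> \<theta>" if "x \<in> carrier L" for x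
      using e that by (auto simp: equiv_def refl_on_def)
    have all: "(b, \<bottom>) \<in> \<theta>" if xy: "(x, y) \<in> \<theta>" "\<not> x \<sqsubseteq> y" and b: "b \<in> carrier L" for x y b
    proof -
      obtain s where s: "s \<in> carrier R" "\<forall>x\<in>carrier L. \<rho> s x = (if x \<sqsubseteq> y then \<bottom> else b)"
        using elem[OF in_L(2)[OF xy(1)] b] by auto
      then have "\<rho> s x = b" "\<rho> s y = \<bottom>" using in_L[OF xy(1)] xy(2) by auto
      then show ?thesis using sm[OF s(1) xy(1)] by simp
    qed
    show ?thesis
    proof (cases "\<exists>x y. (x, y) \<in> \<theta> \<and> \<not> x \<sqsubseteq> y")
      case True
      then obtain x y where xy: "(x, y) \<in> \<theta>" "\<not> x \<sqsubseteq> y" by (elim exE conjE)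
      have bot: "(b, \<bottom>) \<in> \<theta>" if "b \<in> carrier L" for b
        by (rule all[OF xy that])
      have "(b, c) \<in> \<theta>" if "b \<in> carrier L" "c \<in> carrier L" for b c
        by (rule trans[OF bot[OF that(1)] sym[OF bot[OF that(2)]]])
      moreover have "\<theta> \<subseteq> carrier L \<times> carrier L" using e by (simp add: equiv_def)
      ultimately have "\<theta> = carrier L \<times> carrier L" by (intro subset_antisym subrelI) blast+
      then show ?thesis by (simp add: M)
    next
      case False
      then have "x = y" if "(x, y) \<in> \<theta>" for x y
        using that sym[OF that] in_L[OF that] le_antisym[of x y] by blast
      then have "\<theta> \<subseteq> Id_on (carrier L)" using in_L(1) by (intro subrelI) (simp add: Id_on_iff)
      moreover have "Id_on (carrier L) \<subseteq> \<theta>" using refl by (intro subrelI) (simp add: Id_on_iff)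
      ultimately have "\<theta> = Id_on (carrier L)" by (rule subset_antisym)
      then show ?thesis by (simp add: M)
    qed
  qed
  have "\<exists>r\<in>carrier R. \<exists>x\<in>carrier ?M. r \<odot>\<^bsub>?M\<^esub> x \<noteq> \<zero>\<^bsub>?M\<^esub>"
    using z nz(1) by (auto simp: M)
  then show "simple_semimodule R ?M"
    using semimodule_endo_semimodule[OF R \<rho>] sub cong by (simp add: simple_semimodule_def)
qed

end

section \<open>Simple semimodules give dense endomorphism hemirings\<close>

definition semimodule_order :: "('a, 'm, 'y) module_scheme \<Rightarrow> 'm gorder" where
  "semimodule_order M = \<lparr> carrier = carrier M, eq = (=), le = (\<lambda>x y. x \<oplus>\<^bsub>M\<^esub> y = y) \<rparr>"

definition action :: "('a, 'm, 'y) module_scheme \<Rightarrow> 'a \<Rightarrow> 'm \<Rightarrow> 'm" where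
  "action M r = (\<lambda>x\<in>carrier M. r \<odot>\<^bsub>M\<^esub> x)"

text \<open>Join and bottom of an order are given by choice, so their agreement with addition and zero
  comes from uniqueness of least elements.\<close>

lemma semilattice_semimodule_order:
  fixes M :: "('a, 'm, 'y) module_scheme"
  assumes "abelian_monoid M" and idem: "\<And>x. x \<in> carrier M \<Longrightarrow> x \<oplus>\<^bsub>M\<^esub> x = x"
  shows "semilattice_with_zero (semimodule_order M)"
    and "\<lbrakk> x \<in> carrier M; y \<in> carrier M \<rbrakk> \<Longrightarrow> x \<squnion>\<^bsub>semimodule_order M\<^esub> y = x \<oplus>\<^bsub>M\<^esub> y"
    and "\<bottom>\<^bsub>semimodule_order M\<^esub> = \<zero>\<^bsub>M\<^esub>"
proof -
  interpret M: abelian_monoid M by fact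
  let ?L = "semimodule_order M"
  have L: "carrier ?L = carrier M" "gorder.le ?L = (\<lambda>x y. x \<oplus>\<^bsub>M\<^esub> y = y)" "eq ?L = (=)"
    by (simp_all add: semimodule_order_def)
  have po: "partial_order ?L"
  proof (unfold_locales, goal_cases)
    case (5 x y) then show ?case using M.a_comm by (auto simp: L)
  next
    case (6 x y z) then show ?case using M.a_assoc by (auto simp: L) metis
  qed (auto simp: L idem)
  have lub: "least ?L (x \<oplus>\<^bsub>M\<^esub> y) (Upper ?L {x, y})" if "x \<in> carrier M" "y \<in> carrier M" for x y
  proof -
    have "y \<oplus>\<^bsub>M\<^esub> (x \<oplus>\<^bsub>M\<^esub> y) = x \<oplus>\<^bsub>M\<^esub> y"
      using that idem by (simp add: M.a_lcomm)
    moreover have "x \<oplus>\<^bsub>M\<^esub> (x \<oplus>\<^bsub>M\<^esub> y) = x \<oplus>\<^bsub>M\<^esub> y"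
      using that idem by (simp add: M.a_assoc[symmetric])
    ultimately show ?thesis
      using that by (auto simp: least_def Upper_def L M.a_assoc)
  qed
  have bot: "least ?L \<zero>\<^bsub>M\<^esub> (carrier ?L)"
    by (auto simp: least_def L)
  interpret L: partial_order ?L by (rule po)
  show sl: "semilattice_with_zero ?L"
    by (intro semilattice_with_zero.intro upper_semilattice.intro po
          upper_semilattice_axioms.intro weak_partial_order_bottom.intro
          weak_partial_order_bottom_axioms.intro L.weak_partial_order_axioms)
       (use lub bot in \<open>auto simp: L\<close>)
  interpret L: semilattice_with_zero ?L by (rule sl)
  show "x \<squnion>\<^bsub>?L\<^esub> y = x \<oplus>\<^bsub>M\<^esub> y" if "x \<in> carrier M" "y \<in> carrier M"
    unfolding join_def sup_def
    by (rule some_equality) (use lub[OF that] L.least_unique in auto)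
  show "\<bottom>\<^bsub>?L\<^esub> = \<zero>\<^bsub>M\<^esub>"
    using L.least_unique[OF L.bottom_least bot] .
qed

context semimodule
begin

lemma action_hom:
  assumes idem: "\<And>x. x \<in> carrier M \<Longrightarrow> x \<oplus>\<^bsub>M\<^esub> x = x"
  shows "action M \<in> hemiring_hom R (End_hemiring (semimodule_order M))"
proof -
  note so = semilattice_semimodule_order(2,3)[OF M.abelian_monoid_axioms idem]
  have [simp]: "carrier (semimodule_order M) = carrier M" by (simp add: semimodule_order_def)
  show ?thesis
    by (auto simp: hemiring_hom_def End_hemiring_def action_def compose_def so fun_eq_iff
        smult_closed smult_assoc smult_r_distr smult_l_distr smult_r_null smult_l_null R.m_closed)
qed

text \<open>The element \<open>s\<close> is the sum of \<open>A\<close>: in an idempotent semimodule a sum acts as the join of its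
  summands, and it stays in every submonoid containing them.\<close>

lemma common_upper_bound_in_submonoid:
  assumes idem: "\<And>x. x \<in> carrier M \<Longrightarrow> x \<oplus>\<^bsub>M\<^esub> x = x"
    and J: "submonoid J (add_monoid R)" and "finite A" "A \<subseteq> J"
  shows "\<exists>s\<in>J. \<forall>r\<in>A. \<forall>x\<in>carrier M. r \<odot>\<^bsub>M\<^esub> x \<oplus>\<^bsub>M\<^esub> s \<odot>\<^bsub>M\<^esub> x = s \<odot>\<^bsub>M\<^esub> x"
  using assms(3,4)
proof (induction A rule: finite_induct)
  case empty
  show ?case using submonoid.one_closed[OF J] by auto
next
  case (insert a A)
  interpret J: submonoid J "add_monoid R" by (rule J)
  have JR: "r \<in> carrier R" if "r \<in> J" for r using J.subset that by auto
  obtain s where s: "s \<in> J"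
    "\<And>r x. \<lbrakk> r \<in> A; x \<in> carrier M \<rbrakk> \<Longrightarrow> r \<odot>\<^bsub>M\<^esub> x \<oplus>\<^bsub>M\<^esub> s \<odot>\<^bsub>M\<^esub> x = s \<odot>\<^bsub>M\<^esub> x"
    using insert by auto
  have a: "a \<in> J" using insert by auto
  show ?case
  proof (intro bexI[of _ "a \<oplus>\<^bsub>R\<^esub> s"] ballI)
    show "a \<oplus>\<^bsub>R\<^esub> s \<in> J" using J.m_closed[OF a s(1)] by simp
    show "r \<odot>\<^bsub>M\<^esub> x \<oplus>\<^bsub>M\<^esub> (a \<oplus>\<^bsub>R\<^esub> s) \<odot>\<^bsub>M\<^esub> x = (a \<oplus>\<^bsub>R\<^esub> s) \<odot>\<^bsub>M\<^esub> x"
      if r: "r \<in> insert a A" and x: "x \<in> carrier M" for r x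
    proof (cases "r = a")
      case True
      then show ?thesis using JR[OF a] JR[OF s(1)] x idem[of "a \<odot>\<^bsub>M\<^esub> x"]
        by (simp add: smult_l_distr smult_closed M.a_assoc[symmetric])
    next
      case False
      then have "r \<in> A" "r \<in> carrier R" using r insert(4) JR by auto
      then show ?thesis using s(2)[of r x] JR[OF a] JR[OF s(1)] x
        by (simp add: smult_l_distr smult_closed M.a_lcomm)
    qed
  qed
qed

end

lemma (in abelian_monoid) idempotent_sum_zero_iff:
  assumes "\<And>x. x \<in> carrier G \<Longrightarrow> x \<oplus> x = x" "u \<in> carrier G" "v \<in> carrier G"
  shows "u \<oplus> v = \<zero> \<longleftrightarrow> u = \<zero> \<and> v = \<zero>"
  using assms by (metis a_assoc l_zero r_zero)

lemma finite_simple_semimodule: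
  assumes "simple_semimodule R M" "finite (carrier R)"
  shows "finite (carrier M)"
proof -
  obtain m where "(\<lambda>r. r \<odot>\<^bsub>M\<^esub> m) ` carrier R = carrier M"
    using simple_semimodule_cyclic[OF assms(1)] .
  then show ?thesis using assms(2) finite_imageI by metis
qed

text \<open>Idempotency passes from \<open>R\<close> to \<open>M\<close> because every element of a simple semimodule has the form
  \<open>rm\<close> for a fixed generator \<open>m\<close>.\<close>

lemma simple_semimodule_idempotent:
  assumes M: "simple_semimodule R M" and "additively_idempotent R" "x \<in> carrier M"
  shows "x \<oplus>\<^bsub>M\<^esub> x = x"
proof -
  interpret semimodule R M using M by (simp add: simple_semimodule_def)
  obtain m where m: "m \<in> carrier M" "(\<lambda>r. r \<odot>\<^bsub>M\<^esub> m) ` carrier R = carrier M"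
    using simple_semimodule_cyclic[OF M] .
  then obtain r where "r \<in> carrier R" "x = r \<odot>\<^bsub>M\<^esub> m" using assms(3) by auto
  then show ?thesis
    using assms(2) m(1) smult_l_distr[of r r m] by (simp add: additively_idempotent_def)
qed

text \<open>Relating points with the same annihilator in \<open>R\<close> is compatible with addition because sums
  vanish only if both summands do. Simplicity leaves the diagonal, as the full relation would
  make every point share the annihilator of \<open>0\<close>, giving \<open>RM = 0\<close>.\<close>

lemma simple_semimodule_point_annihilator_inj:
  assumes M: "simple_semimodule R M" and "additively_idempotent R"
    and xy: "x \<in> carrier M" "y \<in> carrier M"
    and eq: "\<And>r. r \<in> carrier R \<Longrightarrow> r \<odot>\<^bsub>M\<^esub> x = \<zero>\<^bsub>M\<^esub> \<longleftrightarrow> r \<odot>\<^bsub>M\<^esub> y = \<zero>\<^bsub>M\<^esub>"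
  shows "x = y"
proof -
  interpret semimodule R M using M by (simp add: simple_semimodule_def)
  note idem = simple_semimodule_idempotent[OF assms(1,2)]
  note sum_zero_iff = M.idempotent_sum_zero_iff[OF idem]
  define \<theta> where "\<theta> = {(u, v). u \<in> carrier M \<and> v \<in> carrier M \<and>
     (\<forall>r\<in>carrier R. r \<odot>\<^bsub>M\<^esub> u = \<zero>\<^bsub>M\<^esub> \<longleftrightarrow> r \<odot>\<^bsub>M\<^esub> v = \<zero>\<^bsub>M\<^esub>)}"
  have "equiv (carrier M) \<theta>"
    by (intro equivI refl_onI symI transI) (auto simp: \<theta>_def)
  moreover have "(u \<oplus>\<^bsub>M\<^esub> v, u' \<oplus>\<^bsub>M\<^esub> v') \<in> \<theta>" if "(u, u') \<in> \<theta>" "(v, v') \<in> \<theta>" for u u' v v'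
    using that by (auto simp: \<theta>_def smult_r_distr smult_closed sum_zero_iff)
  moreover have "(r \<odot>\<^bsub>M\<^esub> u, r \<odot>\<^bsub>M\<^esub> v) \<in> \<theta>" if "r \<in> carrier R" "(u, v) \<in> \<theta>" for r u v
    using that by (auto simp: \<theta>_def smult_assoc[symmetric] smult_closed R.m_closed)
  ultimately have "semimodule_congruence \<theta> R M"
    by (simp add: semimodule_congruence_def)
  then have "\<theta> = Id_on (carrier M) \<or> \<theta> = carrier M \<times> carrier M"
    using M by (simp add: simple_semimodule_def)
  moreover have "\<theta> \<noteq> carrier M \<times> carrier M"
  proof
    assume all: "\<theta> = carrier M \<times> carrier M"
    obtain r z where rz: "r \<in> carrier R" "z \<in> carrier M" "r \<odot>\<^bsub>M\<^esub> z \<noteq> \<zero>\<^bsub>M\<^esub>"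
      using M by (auto simp: simple_semimodule_def)
    then have "(\<zero>\<^bsub>M\<^esub>, z) \<in> \<theta>" using all by simp
    then show False using rz by (auto simp: \<theta>_def smult_r_null)
  qed
  moreover have "(x, y) \<in> \<theta>" using xy eq by (simp add: \<theta>_def)
  ultimately show ?thesis by auto
qed

lemma (in semimodule) subsemimodule_ideal_orbit:
  assumes J: "submonoid J (add_monoid R)" "\<And>r s. \<lbrakk> r \<in> carrier R; s \<in> J \<rbrakk> \<Longrightarrow> r \<otimes>\<^bsub>R\<^esub> s \<in> J"
    and x: "x \<in> carrier M"
  shows "subsemimodule ((\<lambda>r. r \<odot>\<^bsub>M\<^esub> x) ` J) R M"
proof -
  interpret J: submonoid J "add_monoid R" by fact
  have JR: "r \<in> carrier R" if "r \<in> J" for r using J.subset that by auto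
  have "submonoid ((\<lambda>r. r \<odot>\<^bsub>M\<^esub> x) ` J) (add_monoid M)"
  proof (rule submonoid.intro)
    show "\<one>\<^bsub>add_monoid M\<^esub> \<in> (\<lambda>r. r \<odot>\<^bsub>M\<^esub> x) ` J"
      by (rule image_eqI[where x = "\<zero>\<^bsub>R\<^esub>"]) (use J.one_closed smult_l_null[OF x] in auto)
  next
    fix u v assume "u \<in> (\<lambda>r. r \<odot>\<^bsub>M\<^esub> x) ` J" "v \<in> (\<lambda>r. r \<odot>\<^bsub>M\<^esub> x) ` J"
    then obtain s t where "s \<in> J" "u = s \<odot>\<^bsub>M\<^esub> x" "t \<in> J" "v = t \<odot>\<^bsub>M\<^esub> x" by auto
    then show "u \<otimes>\<^bsub>add_monoid M\<^esub> v \<in> (\<lambda>r. r \<odot>\<^bsub>M\<^esub> x) ` J"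
      using J.m_closed[of s t] x JR by (intro image_eqI[where x = "s \<oplus>\<^bsub>R\<^esub> t"]) (auto simp: smult_l_distr)
  qed (use JR x smult_closed in auto)
  moreover have "r \<odot>\<^bsub>M\<^esub> u \<in> (\<lambda>r. r \<odot>\<^bsub>M\<^esub> x) ` J"
    if r: "r \<in> carrier R" and u: "u \<in> (\<lambda>r. r \<odot>\<^bsub>M\<^esub> x) ` J" for r u
  proof -
    obtain s where s: "s \<in> J" "u = s \<odot>\<^bsub>M\<^esub> x" using u by auto
    then have "r \<odot>\<^bsub>M\<^esub> u = (r \<otimes>\<^bsub>R\<^esub> s) \<odot>\<^bsub>M\<^esub> x" using r x JR smult_assoc by simp
    then show ?thesis using J(2)[OF r s(1)] by blast
  qed
  ultimately show ?thesis by (simp add: subsemimodule_def)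
qed

text \<open>The core of the density theorem. With \<open>J = (0:a)\<close>, every orbit \<open>Jx\<close> with \<open>x \<not>\<le> a\<close> is all of
  \<open>M\<close>, so the largest element \<open>s\<close> of \<open>J\<close> acts as \<open>e\<^bsub>a,t\<^esub>\<close> with \<open>t\<close> the greatest element of \<open>M\<close>;
  a multiple of \<open>s\<close> then acts as \<open>e\<^bsub>a,b\<^esub>\<close>.\<close>

lemma elementary_action_exists:
  assumes M: "simple_semimodule R M" and idR: "additively_idempotent R"
    and fin: "finite (carrier R)" and ab: "a \<in> carrier M" "b \<in> carrier M"
  obtains r where "r \<in> carrier R"
    "\<And>x. x \<in> carrier M \<Longrightarrow> r \<odot>\<^bsub>M\<^esub> x = (if x \<oplus>\<^bsub>M\<^esub> a = a then \<zero>\<^bsub>M\<^esub> else b)"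
proof -
  interpret semimodule R M using M by (simp add: simple_semimodule_def)
  note idem = simple_semimodule_idempotent[OF M idR]
  note inj = simple_semimodule_point_annihilator_inj[OF M idR]
  note sum_zero_iff = M.idempotent_sum_zero_iff[OF idem]
  define J where "J = {r \<in> carrier R. r \<odot>\<^bsub>M\<^esub> a = \<zero>\<^bsub>M\<^esub>}"
  have Jsub: "submonoid J (add_monoid R)"
    by (rule submonoid.intro) (auto simp: J_def ab smult_l_distr smult_l_null)
  have Jid: "r \<otimes>\<^bsub>R\<^esub> s \<in> J" if "r \<in> carrier R" "s \<in> J" for r s
    using that ab by (auto simp: J_def R.m_closed smult_assoc smult_r_null)
  have JR: "J \<subseteq> carrier R" by (auto simp: J_def)
  have orbit: "(\<lambda>r. r \<odot>\<^bsub>M\<^esub> x) ` J = carrier M"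
    if x: "x \<in> carrier M" "x \<oplus>\<^bsub>M\<^esub> a \<noteq> a" for x
  proof (rule ccontr)
    assume "(\<lambda>r. r \<odot>\<^bsub>M\<^esub> x) ` J \<noteq> carrier M"
    then have 0: "(\<lambda>r. r \<odot>\<^bsub>M\<^esub> x) ` J = {\<zero>\<^bsub>M\<^esub>}"
      using M subsemimodule_ideal_orbit[OF Jsub Jid x(1)] by (auto simp: simple_semimodule_def)
    \<comment> \<open>Now \<open>(0:a) \<subseteq> (0:x)\<close>, so \<open>x + a\<close> and \<open>a\<close> have the same annihilator.\<close>
    have "x \<oplus>\<^bsub>M\<^esub> a = a"
    proof (rule inj)
      fix r assume r: "r \<in> carrier R"
      have "r \<odot>\<^bsub>M\<^esub> x = \<zero>\<^bsub>M\<^esub>" if "r \<odot>\<^bsub>M\<^esub> a = \<zero>\<^bsub>M\<^esub>"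
        using 0 r that by (auto simp: J_def)
      then show "r \<odot>\<^bsub>M\<^esub> (x \<oplus>\<^bsub>M\<^esub> a) = \<zero>\<^bsub>M\<^esub> \<longleftrightarrow> r \<odot>\<^bsub>M\<^esub> a = \<zero>\<^bsub>M\<^esub>"
        using r ab x(1) by (auto simp: smult_r_distr sum_zero_iff smult_closed)
    qed (use ab x in auto)
    with x(2) show False ..
  qed
  obtain s where sJ: "s \<in> J"
    and s_ub: "\<And>r x. \<lbrakk> r \<in> J; x \<in> carrier M \<rbrakk> \<Longrightarrow> r \<odot>\<^bsub>M\<^esub> x \<oplus>\<^bsub>M\<^esub> s \<odot>\<^bsub>M\<^esub> x = s \<odot>\<^bsub>M\<^esub> x"
    using common_upper_bound_in_submonoid[OF idem Jsub finite_subset[OF JR fin]] by auto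
  have s: "s \<in> carrier R" using sJ JR by auto
  have top: "y \<oplus>\<^bsub>M\<^esub> s \<odot>\<^bsub>M\<^esub> x = s \<odot>\<^bsub>M\<^esub> x"
    if x: "x \<in> carrier M" "x \<oplus>\<^bsub>M\<^esub> a \<noteq> a" and y: "y \<in> carrier M" for x y
  proof -
    have "y \<in> (\<lambda>r. r \<odot>\<^bsub>M\<^esub> x) ` J" using orbit[OF x] y by simp
    then obtain r where "r \<in> J" "y = r \<odot>\<^bsub>M\<^esub> x" by auto
    then show ?thesis using s_ub x(1) by simp
  qed
  \<comment> \<open>Multiplication by \<open>s\<close> is monotone and \<open>sa = 0\<close>.\<close>
  have below: "s \<odot>\<^bsub>M\<^esub> x = \<zero>\<^bsub>M\<^esub>" if "x \<in> carrier M" "x \<oplus>\<^bsub>M\<^esub> a = a" for x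
  proof -
    have "s \<odot>\<^bsub>M\<^esub> x \<oplus>\<^bsub>M\<^esub> s \<odot>\<^bsub>M\<^esub> a = s \<odot>\<^bsub>M\<^esub> a"
      using that ab s smult_r_distr by metis
    then show ?thesis using sJ that s by (simp add: J_def smult_closed)
  qed
  \<comment> \<open>If \<open>a\<close> is the greatest element, \<open>e\<^bsub>a,b\<^esub>\<close> is zero and \<open>s\<close> itself serves; otherwise some point
    \<open>x0\<close> witnesses that \<open>t = s x0\<close> is the greatest element.\<close>
  show ?thesis
  proof (cases "\<exists>x\<in>carrier M. x \<oplus>\<^bsub>M\<^esub> a \<noteq> a")
    case False
    then show ?thesis using below s that[of s] by auto
  next
    case True
    then obtain x0 where x0: "x0 \<in> carrier M" "x0 \<oplus>\<^bsub>M\<^esub> a \<noteq> a" by auto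
    define t where "t = s \<odot>\<^bsub>M\<^esub> x0"
    have t: "t \<in> carrier M" using x0 s by (simp add: t_def smult_closed)
    have eq_t: "s \<odot>\<^bsub>M\<^esub> x = t" if x: "x \<in> carrier M" "x \<oplus>\<^bsub>M\<^esub> a \<noteq> a" for x
      using top[OF x t] top[OF x0, of "s \<odot>\<^bsub>M\<^esub> x"] x s t M.a_comm
      by (metis smult_closed t_def)
    have "(\<lambda>r. r \<odot>\<^bsub>M\<^esub> t) ` carrier R = carrier M"
    proof (rule ccontr)
      assume "(\<lambda>r. r \<odot>\<^bsub>M\<^esub> t) ` carrier R \<noteq> carrier M"
      moreover have "submonoid (carrier R) (add_monoid R)" by (rule submonoid.intro) auto
      then have "subsemimodule ((\<lambda>r. r \<odot>\<^bsub>M\<^esub> t) ` carrier R) R M"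
        using R.m_closed t by (rule subsemimodule_ideal_orbit)
      ultimately have 0: "(\<lambda>r. r \<odot>\<^bsub>M\<^esub> t) ` carrier R = {\<zero>\<^bsub>M\<^esub>}"
        using M unfolding simple_semimodule_def by blast
      have "r \<odot>\<^bsub>M\<^esub> x = \<zero>\<^bsub>M\<^esub>" if rx: "r \<in> carrier R" "x \<in> carrier M" for r x
      proof -
        have "r \<odot>\<^bsub>M\<^esub> x \<oplus>\<^bsub>M\<^esub> r \<odot>\<^bsub>M\<^esub> t = r \<odot>\<^bsub>M\<^esub> t"
          using top[OF x0 rx(2)] rx t smult_r_distr t_def by metis
        moreover have "r \<odot>\<^bsub>M\<^esub> t = \<zero>\<^bsub>M\<^esub>" using 0 rx(1) by auto
        ultimately show ?thesis using rx by (simp add: smult_closed)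
      qed
      then show False using M by (auto simp: simple_semimodule_def)
    qed
    then obtain q where q: "q \<in> carrier R" "q \<odot>\<^bsub>M\<^esub> t = b" using ab(2) by (metis imageE)
    show ?thesis
      by (rule that[of "q \<otimes>\<^bsub>R\<^esub> s"])
         (use q s below eq_t in \<open>auto simp: R.m_closed smult_assoc smult_r_null\<close>)
  qed
qed

lemma dense_action:
  assumes M: "simple_semimodule R M" and idR: "additively_idempotent R"
    and fin: "finite (carrier R)"
  shows "dense_subhemiring (action M ` carrier R) (semimodule_order M)"
proof -
  interpret semimodule R M using M by (simp add: simple_semimodule_def)
  note idem = simple_semimodule_idempotent[OF M idR]
  let ?L = "semimodule_order M"
  let ?D = "action M ` carrier R"
  have L: "carrier ?L = carrier M" "gorder.le ?L = (\<lambda>x y. x \<oplus>\<^bsub>M\<^esub> y = y)"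
    by (simp_all add: semimodule_order_def)
  have bot: "\<bottom>\<^bsub>?L\<^esub> = \<zero>\<^bsub>M\<^esub>"
    by (rule semilattice_semimodule_order(3)[OF M.abelian_monoid_axioms idem])
  have sub: "subhemiring ?D (End_hemiring ?L)"
    by (rule subhemiring_image[OF R.hemiring_axioms action_hom[OF idem]])
  have "elementary_endo ?L a b \<in> ?D" if ab: "a \<in> carrier ?L" "b \<in> carrier ?L" for a b
  proof -
    obtain r where r: "r \<in> carrier R"
      "\<And>x. x \<in> carrier M \<Longrightarrow> r \<odot>\<^bsub>M\<^esub> x = (if x \<oplus>\<^bsub>M\<^esub> a = a then \<zero>\<^bsub>M\<^esub> else b)"
      using elementary_action_exists[OF M idR fin] ab unfolding L by metis
    then have "elementary_endo ?L a b = action M r"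
      by (auto simp: elementary_endo_def action_def L bot fun_eq_iff)
    then show ?thesis using r(1) by auto
  qed
  then have "F_submonoid ?L \<subseteq> ?D"
    using sub by (auto simp: F_submonoid_def subhemiring_def)
  with sub show ?thesis by (simp add: dense_subhemiring_def)
qed

text \<open>The dummy argument fixes the type that carries the semilattice, which does not occur in the
  type of the hemiring.\<close>

definition dense_endo_hemiring :: "'m::infinite itself \<Rightarrow> ('s, 'z) ring_scheme \<Rightarrow> bool" where
  "dense_endo_hemiring _ S \<longleftrightarrow> hemiring S \<and>
     (\<exists>(L :: 'm gorder) D. semilattice_with_zero L \<and> finite (carrier L) \<and>
        dense_subhemiring D L \<and> hemiring_isomorphic S ((End_hemiring L)\<lparr>carrier := D\<rparr>))"

text \<open>A simple semimodule gives one factor of a subdirect product: the hemiring of maps by which \<open>R\<close>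
  acts. Both the semimodule and this hemiring are finite, so they can be moved to the prescribed
  infinite types without changing the annihilator.\<close>

lemma simple_semimodule_factor:
  fixes M :: "('a, 'n, 'y) module_scheme"
  assumes M: "simple_semimodule R M" and idR: "additively_idempotent R"
    and fin: "finite (carrier R)"
  obtains S :: "'s::infinite ring" and \<phi>
  where "dense_endo_hemiring TYPE('m::infinite) S" "\<phi> \<in> hemiring_hom R S"
    "\<phi> ` carrier R = carrier S"
    "\<And>r. \<lbrakk> r \<in> carrier R; \<phi> r = \<zero>\<^bsub>S\<^esub> \<rbrakk> \<Longrightarrow> r \<in> left_annihilator R M"
proof -
  have finM: "finite (carrier M)"
    by (rule finite_simple_semimodule[OF M fin])
  then obtain g :: "'n \<Rightarrow> 'm" where "inj_on g (carrier M)"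
    using arb_inj_on_finite_infinite by blast
  then obtain N :: "('a, 'm) module" where N: "simple_semimodule R N"
    "left_annihilator R N = left_annihilator R M"
    using simple_semimodule_transport[OF M] by blast
  interpret semimodule R N using N by (simp add: simple_semimodule_def)
  note idem = simple_semimodule_idempotent[OF N(1) idR]
  note so = semilattice_semimodule_order[OF M.abelian_monoid_axioms idem]
  let ?L = "semimodule_order N"
  let ?D = "action N ` carrier R"
  let ?E = "(End_hemiring ?L)\<lparr>carrier := ?D\<rparr>"
  note hom = action_hom[OF idem]
  have finN: "finite (carrier ?L)"
    using finite_simple_semimodule[OF N(1) fin] by (simp add: semimodule_order_def)
  have dense: "dense_subhemiring ?D ?L" by (rule dense_action[OF N(1) idR fin])
  have hemE: "hemiring ?E"
    using semilattice_with_zero.hemiring_End_hemiring[OF so(1)] dense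
    by (intro hemiring_subhemiring) (auto simp: dense_subhemiring_def)
  have homE: "action N \<in> hemiring_hom R ?E"
    using hom by (auto simp: hemiring_hom_def)
  obtain e :: "('m \<Rightarrow> 'm) \<Rightarrow> 's" where e: "inj_on e ?D"
    using arb_inj_on_finite_infinite[of ?D] fin by blast
  then obtain S :: "'s ring" where S: "hemiring S" "e \<in> hemiring_hom ?E S"
    "carrier S = e ` ?D" "hemiring_isomorphic S ?E"
    using hemiring_transport[OF hemE, of e] by auto
  show ?thesis
  proof (rule that)
    show "dense_endo_hemiring TYPE('m) S"
      using S so(1) finN dense by (auto simp: dense_endo_hemiring_def)
    show "(\<lambda>r. e (action N r)) \<in> hemiring_hom R S"
      by (rule hemiring_hom_comp[OF homE S(2)])
    show "(\<lambda>r. e (action N r)) ` carrier R = carrier S"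
      by (simp add: S(3) image_image)
    fix r assume r: "r \<in> carrier R" "e (action N r) = \<zero>\<^bsub>S\<^esub>"
    then have "e (action N r) = e (action N \<zero>\<^bsub>R\<^esub>)"
      using hemiring_homD(4)[OF S(2)] hemiring_homD(4)[OF homE] by simp
    then have "action N r = action N \<zero>\<^bsub>R\<^esub>"
      using e r(1) by (auto dest: inj_onD)
    then have "r \<odot>\<^bsub>N\<^esub> x = \<zero>\<^bsub>N\<^esub>" if "x \<in> carrier N" for x
      using that fun_cong[OF \<open>action N r = action N \<zero>\<^bsub>R\<^esub>\<close>, of x] smult_l_null[of x]
      unfolding action_def restrict_def by simp
    then show "r \<in> left_annihilator R M"
      using r(1) unfolding N(2)[symmetric] by (simp add: left_annihilator_def)
  qed
qed

section \<open>The characterization of semisimplicity\<close>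

text \<open>Each factor makes its semilattice an \<open>R\<close>-semimodule, on which \<open>R\<close> acts densely because the
  projection to the factor is onto. An element of \<open>J\<^sub>s(R)\<close> annihilates the simple ones among these,
  and the others are zero, so all its components vanish.\<close>

lemma Js_semisimple_if_subdirect:
  fixes R :: "('a, 'z) ring_scheme" and S :: "'i \<Rightarrow> ('s, 'y) ring_scheme"
  assumes R: "hemiring R"
    and S: "\<And>i. i \<in> I \<Longrightarrow> dense_endo_hemiring TYPE('m::infinite) (S i)"
    and T: "subdirect_product T I S"
    and semi: "semiisomorphic R ((product_hemiring I S)\<lparr>carrier := T\<rparr>)"
  shows "Js_semisimple R"
proof -
  interpret hemiring R by fact
  obtain f where f: "f \<in> hemiring_hom R ((product_hemiring I S)\<lparr>carrier := T\<rparr>)"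
    "f ` carrier R = T" "{a \<in> carrier R. f a = \<zero>\<^bsub>product_hemiring I S\<^esub>} = {\<zero>\<^bsub>R\<^esub>}"
    using semi by (auto simp: semiisomorphic_def semiisomorphism_def)
  have TP: "T \<subseteq> (\<Pi>\<^sub>E i\<in>I. carrier (S i))"
    using T by (auto simp: subdirect_product_def subhemiring_def submonoid_def product_hemiring_def)
  have proj: "(\<lambda>r. f r i) \<in> hemiring_hom R (S i)" if "i \<in> I" for i
    using hemiring_homD[OF f(1)] that TP
    by (auto simp: hemiring_hom_def product_hemiring_def PiE_iff subset_iff)
  have "r = \<zero>\<^bsub>R\<^esub>" if r: "r \<in> Js R" for r
  proof (rule ccontr)
    assume r0: "r \<noteq> \<zero>\<^bsub>R\<^esub>"
    have rR: "r \<in> carrier R" using r by (simp add: Js_def)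
    then have "f r \<noteq> \<zero>\<^bsub>product_hemiring I S\<^esub>" using r0 f(3) by blast
    moreover have "f r \<in> extensional I" using TP f(2) rR by (auto simp: PiE_def)
    moreover have "\<zero>\<^bsub>product_hemiring I S\<^esub> = (\<lambda>i\<in>I. \<zero>\<^bsub>S i\<^esub>)"
      by (simp add: product_hemiring_def)
    ultimately have "\<exists>i\<in>I. f r i \<noteq> \<zero>\<^bsub>S i\<^esub>"
      by (metis (no_types, lifting) extensionalityI restrict_apply' restrict_extensional)
    then obtain i where i: "i \<in> I" "f r i \<noteq> \<zero>\<^bsub>S i\<^esub>" by auto
    obtain L :: "'m gorder" and D h where L: "semilattice_with_zero L"
      and D: "dense_subhemiring D L"
      and h: "h \<in> hemiring_hom (S i) ((End_hemiring L)\<lparr>carrier := D\<rparr>)"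
        "bij_betw h (carrier (S i)) D"
      using S[OF i(1)] by (auto simp: dense_endo_hemiring_def hemiring_isomorphic_def)
    interpret L: semilattice_with_zero L by (rule L)
    define \<rho> where "\<rho> s = h (f s i)" for s
    have DE: "D \<subseteq> carrier (End_hemiring L)"
      using D by (auto simp: dense_subhemiring_def subhemiring_def submonoid_def)
    have "\<rho> \<in> hemiring_hom R ((End_hemiring L)\<lparr>carrier := D\<rparr>)"
      unfolding \<rho>_def by (rule hemiring_hom_comp[OF proj[OF i(1)] h(1)])
    then have \<rho>: "\<rho> \<in> hemiring_hom R (End_hemiring L)"
      using DE by (auto simp: hemiring_hom_def)
    have "\<rho> ` carrier R = h ` (\<lambda>t. t i) ` T"
      by (simp add: \<rho>_def f(2)[symmetric] image_image)
    also have "\<dots> = D"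
      using T i(1) h(2) by (simp add: subdirect_product_def bij_betw_def)
    finally have dense: "dense_subhemiring (\<rho> ` carrier R) L" using D by simp
    have "\<rho> r \<noteq> \<zero>\<^bsub>End_hemiring L\<^esub>"
    proof
      assume "\<rho> r = \<zero>\<^bsub>End_hemiring L\<^esub>"
      then have "h (f r i) = h \<zero>\<^bsub>S i\<^esub>"
        using hemiring_homD(4)[OF h(1)] by (simp add: \<rho>_def)
      moreover have "f r i \<in> carrier (S i)" "\<zero>\<^bsub>S i\<^esub> \<in> carrier (S i)"
        using hemiring_homD(1,4)[OF proj[OF i(1)]] rR by (auto, metis zero_closed)
      ultimately show False using h(2) i(2) by (auto simp: bij_betw_def dest: inj_onD)
    qed
    then show False
      using L.simple_endo_semimodule[OF R \<rho> dense rR] r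
        Js_subset_left_annihilator[of R "endo_semimodule L \<rho>"] by blast
  qed
  moreover have "\<zero>\<^bsub>R\<^esub> \<in> Js R"
    by (auto simp: Js_def left_annihilator_def simple_semimodule_def semimodule.smult_l_null)
  ultimately have "Js R = {\<zero>\<^bsub>R\<^esub>}" by blast
  then show ?thesis by (simp add: Js_semisimple_def)
qed

text \<open>The factors are indexed by the nonzero elements of \<open>R\<close>, the one at \<open>r\<close> coming from a simple
  semimodule that \<open>r\<close> does not annihilate. An injection \<open>e\<close> with inverse \<open>d\<close> moves these finitely
  many indices into the prescribed type.\<close>

lemma subdirect_if_Js_semisimple:
  fixes R :: "('a, 'z) ring_scheme"
  assumes R: "hemiring R" and fin: "finite (carrier R)" and idR: "additively_idempotent R"
    and ss: "Js_semisimple R"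
  obtains I :: "'i::infinite set" and S :: "'i \<Rightarrow> 's::infinite ring" and T
  where "\<And>i. i \<in> I \<Longrightarrow> dense_endo_hemiring TYPE('m::infinite) (S i)"
    "subdirect_product T I S" "semiisomorphic R ((product_hemiring I S)\<lparr>carrier := T\<rparr>)"
proof -
  let ?X = "carrier R - {\<zero>\<^bsub>R\<^esub>}"
  have "\<exists>(S :: 's ring) \<phi>. dense_endo_hemiring TYPE('m) S \<and> \<phi> \<in> hemiring_hom R S \<and>
      \<phi> ` carrier R = carrier S \<and> \<phi> r \<noteq> \<zero>\<^bsub>S\<^esub>" if r: "r \<in> ?X" for r
  proof -
    obtain M :: "('a, 'a) module" where M: "simple_semimodule R M" "r \<notin> left_annihilator R M"
      using ss r by (auto simp: Js_semisimple_def Js_def)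
    show ?thesis
      by (rule simple_semimodule_factor[OF M(1) idR fin, where 'm = 'm and 's = 's])
         (use M(2) r in blast)
  qed
  then obtain S :: "'a \<Rightarrow> 's ring" and \<phi>
    where S: "\<And>r. r \<in> ?X \<Longrightarrow> dense_endo_hemiring TYPE('m) (S r) \<and> \<phi> r \<in> hemiring_hom R (S r) \<and>
      \<phi> r ` carrier R = carrier (S r) \<and> \<phi> r r \<noteq> \<zero>\<^bsub>S r\<^esub>"
    by metis
  obtain e :: "'a \<Rightarrow> 'i" where e: "inj_on e ?X"
    using arb_inj_on_finite_infinite[of ?X] fin by blast
  define d where "d = inv_into ?X e"
  have d: "d i \<in> ?X" if "i \<in> e ` ?X" for i unfolding d_def by (rule inv_into_into[OF that])
  have de: "d (e r) = r" if "r \<in> ?X" for r using that e by (simp add: d_def)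
  obtain T where "subdirect_product T (e ` ?X) (\<lambda>i. S (d i))"
    "semiisomorphic R ((product_hemiring (e ` ?X) (\<lambda>i. S (d i)))\<lparr>carrier := T\<rparr>)"
  proof (rule semiisomorphic_subdirect_product[OF R, of "e ` ?X" "\<lambda>i. \<phi> (d i)" "\<lambda>i. S (d i)"])
    fix r assume r: "r \<in> carrier R"
      and 0: "\<And>i. i \<in> e ` ?X \<Longrightarrow> \<phi> (d i) r = \<zero>\<^bsub>S (d i)\<^esub>"
    show "r = \<zero>\<^bsub>R\<^esub>"
    proof (rule ccontr)
      assume "r \<noteq> \<zero>\<^bsub>R\<^esub>"
      then have "r \<in> ?X" using r by simp
      then show False using S[of r] 0[of "e r"] de by auto
    qed
  qed (use S d in blast)+
  then show ?thesis using S d by (intro that[of "e ` ?X" "\<lambda>i. S (d i)" T]) auto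
qed

theorem theorem3p11:
  fixes R :: "('a, 'z) ring_scheme"
  assumes "hemiring R" and "finite (carrier R)" and "additively_idempotent R"
  shows "Js_semisimple R \<longleftrightarrow>
    (\<exists>(I :: 'i::infinite set) (S :: 'i \<Rightarrow> 's::infinite ring) T.
       (\<forall>i\<in>I. hemiring (S i) \<and>
          (\<exists>(M :: 'm::infinite gorder) D.
             semilattice_with_zero M \<and> finite (carrier M) \<and> dense_subhemiring D M \<and>
             hemiring_isomorphic (S i) ((End_hemiring M)\<lparr>carrier := D\<rparr>))) \<and>
       subdirect_product T I S \<and>
       semiisomorphic R ((product_hemiring I S)\<lparr>carrier := T\<rparr>))"
proof -
  have "(\<exists>(I :: 'i set) (S :: 'i \<Rightarrow> 's ring) T.
       (\<forall>i\<in>I. dense_endo_hemiring TYPE('m) (S i)) \<and> subdirect_product T I S \<and>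
       semiisomorphic R ((product_hemiring I S)\<lparr>carrier := T\<rparr>))" if "Js_semisimple R"
    by (rule subdirect_if_Js_semisimple[OF assms that, where 'm = 'm and 'i = 'i and 's = 's]) blast
  moreover have "Js_semisimple R"
    if "\<forall>i\<in>I. dense_endo_hemiring TYPE('m) (S i)" "subdirect_product T I S"
      "semiisomorphic R ((product_hemiring I S)\<lparr>carrier := T\<rparr>)"
    for I :: "'i set" and S :: "'i \<Rightarrow> 's ring" and T
    using that by (intro Js_semisimple_if_subdirect[OF assms(1), where 'm = 'm]) auto
  ultimately show ?thesis unfolding dense_endo_hemiring_def by blast
qed

end
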